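(* Let $c_0,c_1>0$, $\tau=\frac{c_0+c_1}2$, $\overline\tau=\frac{c_1-c_0}2$ and $t>0$. The distribution of $Z^{c_0,c_1}_t$ is given by $$\mathbb P(Z^{c_0,c_1}_t\in dx)=e^{-c_0t}\delta_t(dx)+e^{-\tau t}f(t,x)1_{[-t,t]}(x)\,dx,$$ where $$f(t,x)=\frac12\Big[\sqrt{\frac{c_0c_1(t+x)}{t-x}}\,I_1\Big(\sqrt{c_0c_1(t^2-x^2)}\Big)+c_0I_0\Big(\sqrt{c_0c_1(t^2-x^2)}\Big)\Big]e^{\overline\tau x}.$$
   Context: Let $(e_n)_{n\ge1}$ be i.i.d. exponential random variables with $\mathbb E[e_n]=1$, let $\lambda_k=1/c_0$ if $k$ is odd and $\lambda_k=1/c_1$ if $k$ is even, and set $$N^{c_0,c_1}_t=\sum_{k\ge1}1_{\{\lambda_1e_1+\dots+\lambda_ke_k\le t\}},\qquad Z^{c_0,c_1}_t=\int_0^t(-1)^{N^{c_0,c_1}_u}\,du,\qquad t\ge0.$$ $\delta_t$ is the Dirac measure at $t$, and $I_\nu$ is the modified Bessel function $I_\nu(\xi)=\sum_{m\ge0}\frac{(\xi/2)^{\nu+2m}}{m!\,\Gamma(\nu+m+1)}$. *)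

theory Defs
  imports "HOL-Probability.Probability"
begin

definition iid_unit_exponential :: "'a measure \<Rightarrow> (nat \<Rightarrow> 'a \<Rightarrow> real) \<Rightarrow> bool" where
  "iid_unit_exponential M e \<longleftrightarrow>
     prob_space.indep_vars M (\<lambda>_. borel) e {1..} \<and>
     (\<forall>n\<ge>1. distributed M lborel (e n) (exponential_density 1))"

definition waiting_scale :: "real \<Rightarrow> real \<Rightarrow> nat \<Rightarrow> real" where
  "waiting_scale c0 c1 k = (if odd k then 1 / c0 else 1 / c1)"

(* The sum over k of the indicators of the events "k-th jump time <= t".
   On the null event where this sum is infinite, card gives 0. *)
definition jump_count ::
    "real \<Rightarrow> real \<Rightarrow> (nat \<Rightarrow> 'a \<Rightarrow> real) \<Rightarrow> real \<Rightarrow> 'a \<Rightarrow> nat" where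
  "jump_count c0 c1 e t \<omega> =
     card {k. 1 \<le> k \<and> (\<Sum>i=1..k. waiting_scale c0 c1 i * e i \<omega>) \<le> t}"

definition telegraph ::
    "real \<Rightarrow> real \<Rightarrow> (nat \<Rightarrow> 'a \<Rightarrow> real) \<Rightarrow> real \<Rightarrow> 'a \<Rightarrow> real" where
  "telegraph c0 c1 e t \<omega> = (LINT u:{0..t}|lborel. (-1) ^ jump_count c0 c1 e u \<omega>)"

(* Order restricted to natural numbers: the power is then an ordinary one, so that
   the value at 0 is right (0 powr 0 = 0 in HOL would give I_0(0) = 0 instead of 1). *)
definition bessel_I :: "nat \<Rightarrow> real \<Rightarrow> real" where
  "bessel_I \<nu> \<xi> = (\<Sum>m. (\<xi> / 2) ^ (\<nu> + 2 * m) / (fact m * Gamma (real \<nu> + real m + 1)))"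

end

theory Submission
  imports Defs
begin

text \<open>
  Let \<open>Z\<close> be the value of the process at time \<open>t\<close> and \<open>X i\<close> the \<open>i\<close>-th waiting time, exponential
  with rate \<open>c0\<close> for odd \<open>i\<close> and \<open>c1\<close> for even \<open>i\<close>. The velocity is \<open>+1\<close> during the odd waiting
  times and \<open>-1\<close> during the even ones. If exactly \<open>n\<close> jumps have happened by time \<open>t\<close>, the
  current, unfinished waiting time has the parity opposite to \<open>n\<close>, so the total time covered by
  waiting times of the same parity as \<open>n\<close> is a sum of complete waiting times, and the time spent
  with the other velocity is what remains of \<open>t\<close>. Hence \<open>Z\<close> equals \<open>t - 2V\<close> for even \<open>n\<close> and
  \<open>2U - t\<close> for odd \<open>n\<close>, where \<open>U\<close> and \<open>V\<close> are the sums of the odd and of the even waiting times up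
  to \<open>n\<close> (\<open>telegraph_eq_position\<close>).

  Take \<open>n\<close> odd. The event that exactly \<open>n\<close> jumps have happened reads \<open>V \<le> t - U < V + X (n+1)\<close>,
  and \<open>U\<close> is independent of the pair on the two sides. Conditionally on \<open>U = q\<close> it says that a
  renewal process with rate \<open>c1\<close> has made a prescribed number of jumps by time \<open>t - q\<close>, which has
  a Poisson probability (\<open>prob_exponential_sums_straddle\<close>), while \<open>U\<close> itself is Erlang
  distributed. So the part of the law of \<open>Z\<close> carried by this event has a density that is, up
  to a constant factor, a product of two Erlang densities (\<open>emeasure_interleaved_exponential_sums\<close>,
  \<open>emeasure_position_after_jumps\<close>); even \<open>n \<ge> 2\<close> is the same with the roles of the two rates
  exchanged.

  With \<open>p = (t + x) / 2\<close> and \<open>q = (t - x) / 2\<close>, the times spent with velocity \<open>+1\<close> and \<open>-1\<close>, the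
  densities for odd \<open>n\<close> add up to a series in \<open>c0 c1 p q = c0 c1 (t\<^sup>2 - x\<^sup>2) / 4\<close> which, up to
  elementary factors, is that of \<open>I_0\<close>, and those for even \<open>n\<close> to that of \<open>I_1\<close>
  (\<open>position_density_sums\<close>). The event \<open>n = 0\<close>, of probability \<open>exp (- c0 t)\<close>, gives the atom at
  \<open>t\<close>. Almost surely only finitely many jumps happen by time \<open>t\<close> (\<open>AE_finitely_many_jumps\<close>), so
  nothing else contributes.
\<close>

section \<open>The path between two jumps\<close>

definition odd_time :: "(nat \<Rightarrow> real) \<Rightarrow> nat \<Rightarrow> real" where
  "odd_time x n = (\<Sum>i | i \<in> {1..n} \<and> odd i. x i)"

definition even_time :: "(nat \<Rightarrow> real) \<Rightarrow> nat \<Rightarrow> real" where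
  "even_time x n = (\<Sum>i | i \<in> {1..n} \<and> even i. x i)"

text \<open>
  The value at time \<open>u\<close> of a path that has made exactly \<open>n\<close> jumps by then. Only the complete
  waiting times with the parity of \<open>n\<close> are used: the unfinished one has the other parity and is
  eliminated through the fact that the times spent with the two velocities add up to \<open>u\<close>.
\<close>
definition position :: "(nat \<Rightarrow> real) \<Rightarrow> nat \<Rightarrow> real \<Rightarrow> real" where
  "position x n u = (if even n then u - 2 * even_time x n else 2 * odd_time x n - u)"

lemma indices_Suc:
  "{i. i \<in> {1..Suc n} \<and> P i} =
     (if P (Suc n) then insert (Suc n) {i. i \<in> {1..n} \<and> P i} else {i. i \<in> {1..n} \<and> P i})"
  by (auto simp: le_Suc_eq)

lemma odd_time_Suc: "odd_time x (Suc n) = odd_time x n + (if odd (Suc n) then x (Suc n) else 0)"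
  unfolding odd_time_def by (subst indices_Suc) simp

lemma even_time_Suc: "even_time x (Suc n) = even_time x n + (if even (Suc n) then x (Suc n) else 0)"
  unfolding even_time_def by (subst indices_Suc) simp

lemma sum_eq_odd_time_plus_even_time: "(\<Sum>i=1..n. x i) = odd_time x n + even_time x n"
  by (induction n) (simp add: odd_time_def even_time_def, simp add: odd_time_Suc even_time_Suc)

lemma card_odd_indices: "card {i. i \<in> {1..n} \<and> odd i} = Suc n div 2"
proof (induction n)
  case (Suc n)
  show ?case by (subst indices_Suc) (use Suc in auto)
qed simp

lemma card_even_indices: "card {i. i \<in> {1..n} \<and> even i} = n div 2"
proof (induction n)
  case (Suc n)
  show ?case by (subst indices_Suc) (use Suc in auto)
qed simp

context
  fixes x :: "nat \<Rightarrow> real"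
  assumes pos: "\<And>i. 1 \<le> i \<Longrightarrow> 0 < x i"
begin

lemma partial_sum_mono: "m \<le> n \<Longrightarrow> (\<Sum>i=1..m. x i) \<le> (\<Sum>i=1..n. x i)"
  using pos by (intro sum_mono2) (auto intro: less_imp_le)

lemma partial_sums_below:
  assumes "(\<Sum>i=1..n. x i) \<le> u" "u < (\<Sum>i=1..Suc n. x i)"
  shows "{k. 1 \<le> k \<and> (\<Sum>i=1..k. x i) \<le> u} = {1..n}"
proof safe
  fix k assume k: "1 \<le> k" "(\<Sum>i=1..k. x i) \<le> u"
  show "k \<in> {1..n}"
  proof (rule ccontr)
    assume "k \<notin> {1..n}"
    then have "Suc n \<le> k" using k by auto
    from partial_sum_mono[OF this] k assms show False by linarith
  qed
next
  fix k assume "k \<in> {1..n}"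
  then show "1 \<le> k" "(\<Sum>i=1..k. x i) \<le> u"
    using partial_sum_mono[of k n] assms by auto
qed

text \<open>
  Both inequalities on \<open>u\<close> are weak, so that the induction can glue the piece after the \<open>(n+1)\<close>-th
  jump to the induction hypothesis at the jump time itself; the integrand differs from its
  constant value on a piece only at an endpoint.
\<close>
lemma has_integral_sign:
  assumes "(\<Sum>i=1..n. x i) \<le> u" "u \<le> (\<Sum>i=1..Suc n. x i)"
  shows "((\<lambda>u. (-1) ^ card {k. 1 \<le> k \<and> (\<Sum>i=1..k. x i) \<le> u}) has_integral position x n u) {0..u}"
  using assms
proof (induction n arbitrary: u)
  have piece: "((\<lambda>u. (-1) ^ card {k. 1 \<le> k \<and> (\<Sum>i=1..k. x i) \<le> u}) has_integral
      (-1) ^ n * (u - (\<Sum>i=1..n. x i))) {(\<Sum>i=1..n. x i)..u}"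
    if u: "(\<Sum>i=1..n. x i) \<le> u" "u \<le> (\<Sum>i=1..Suc n. x i)" for n u
  proof -
    let ?s = "\<Sum>i=1..n. x i"
    have const: "((\<lambda>_. (-1) ^ n :: real) has_integral (u - ?s) *\<^sub>R (-1) ^ n) (cbox ?s u)"
      using has_integral_const_real[of "(-1) ^ n :: real" ?s u] u by simp
    have "((\<lambda>u. (-1) ^ card {k. 1 \<le> k \<and> (\<Sum>i=1..k. x i) \<le> u}) has_integral
        (u - ?s) *\<^sub>R (-1 :: real) ^ n) (cbox ?s u)"
    proof (rule has_integral_spike_interior[OF const])
      fix v assume "v \<in> box ?s u"
      then have "card {k. 1 \<le> k \<and> (\<Sum>i=1..k. x i) \<le> v} = n"
        using u by (subst partial_sums_below[of n]) auto
      then show "(-1) ^ card {k. 1 \<le> k \<and> (\<Sum>i=1..k. x i) \<le> v} = (-1 :: real) ^ n" by simp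
    qed
    then show ?thesis by (simp add: mult.commute)
  qed
  {
    case 0
    then show ?case using piece[of 0 u] by (simp add: position_def even_time_def)
  next
    case (Suc n)
    let ?s = "\<Sum>i=1..Suc n. x i"
    have s0: "0 \<le> ?s" using partial_sum_mono[of 0 "Suc n"] by simp
    have sn: "(\<Sum>i=1..n. x i) \<le> ?s" by (rule partial_sum_mono) simp
    have *: "position x (Suc n) u = position x n ?s + (-1) ^ Suc n * (u - ?s)"
      unfolding sum_eq_odd_time_plus_even_time position_def
      by (simp add: odd_time_Suc even_time_Suc)
    show ?case unfolding *
      by (rule has_integral_combine[OF s0 Suc.prems(1) Suc.IH[OF sn order_refl] piece[OF Suc.prems]])
  }
qed

end

lemma borel_measurable_jump_count:
  "(\<lambda>u. (-1) ^ jump_count c0 c1 e u \<omega> :: real) \<in> borel_measurable borel"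
proof -
  have "(\<lambda>u. jump_count c0 c1 e u \<omega>) \<in> borel \<rightarrow>\<^sub>M count_space UNIV"
    unfolding jump_count_def by measurable
  then show ?thesis by measurable
qed

lemma telegraph_eq_position:
  assumes "\<And>i. 1 \<le> i \<Longrightarrow> 0 < waiting_scale c0 c1 i * e i \<omega>"
    and "(\<Sum>i=1..n. waiting_scale c0 c1 i * e i \<omega>) \<le> t"
    and "t < (\<Sum>i=1..Suc n. waiting_scale c0 c1 i * e i \<omega>)"
  shows "telegraph c0 c1 e t \<omega> = position (\<lambda>i. waiting_scale c0 c1 i * e i \<omega>) n t"
proof -
  let ?f = "\<lambda>u. (-1) ^ jump_count c0 c1 e u \<omega> :: real"
  have "set_integrable lborel {0..t} ?f"
    unfolding set_integrable_def using borel_measurable_jump_count[of c0 c1 e \<omega>]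
    by (intro integrableI_bounded_set_indicator[where B=1])
       (auto simp: power_abs emeasure_lborel_Icc_eq)
  then have "telegraph c0 c1 e t \<omega> = integral {0..t} ?f"
    unfolding telegraph_def by (rule set_borel_integral_eq_integral(2))
  also have "\<dots> = position (\<lambda>i. waiting_scale c0 c1 i * e i \<omega>) n t"
    unfolding jump_count_def
    by (rule integral_unique[OF has_integral_sign[OF assms(1,2) less_imp_le[OF assms(3)]]])
  finally show ?thesis .
qed

lemma borel_measurable_telegraph:
  assumes "\<And>i. 1 \<le> i \<Longrightarrow> e i \<in> borel_measurable M"
  shows "telegraph c0 c1 e t \<in> borel_measurable M"
proof -
  have [measurable]: "(\<lambda>\<omega>. \<Sum>i=1..k. waiting_scale c0 c1 i * e i \<omega>) \<in> borel_measurable M" for k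
    using assms by (intro borel_measurable_sum borel_measurable_times) auto
  have [measurable]: "(\<lambda>(\<omega>, u). jump_count c0 c1 e u \<omega>) \<in> M \<Otimes>\<^sub>M lborel \<rightarrow>\<^sub>M count_space UNIV"
    unfolding jump_count_def by measurable
  show ?thesis
    unfolding telegraph_def set_lebesgue_integral_def by measurable
qed

section \<open>Interleaved sums of exponential variables\<close>

lemma (in prob_space) AE_exponential_pos:
  assumes "distributed M lborel Y (exponential_density l)" "0 < l"
  shows "AE \<omega> in M. 0 < Y \<omega>"
proof -
  have "prob {\<omega> \<in> space M. 0 < Y \<omega>} = 1"
    using exponential_distributedD_gt[OF assms(1) order_refl assms(2)] by simp
  from AE_prob_1[OF this] show ?thesis by eventually_elim simp
qed

lemma (in prob_space) AE_exponentials_pos: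
  fixes X :: "nat \<Rightarrow> 'a \<Rightarrow> real"
  assumes X: "\<And>i. 1 \<le> i \<Longrightarrow> distributed M lborel (X i) (exponential_density (r i))"
    and r: "\<And>i. 0 < r i"
  shows "AE \<omega> in M. \<forall>i. 1 \<le> i \<longrightarrow> 0 < X i \<omega>"
  unfolding AE_all_countable
proof
  fix i :: nat
  show "AE \<omega> in M. 1 \<le> i \<longrightarrow> 0 < X i \<omega>"
  proof (cases "1 \<le> i")
    case True
    from AE_exponential_pos[OF X[OF True] r] show ?thesis by auto
  qed simp
qed

text \<open>
  The Poisson probability \<open>(b a)\<^sup>n exp (- b a) / n!\<close> of \<open>n = card B\<close> renewals by time \<open>a\<close>, written
  as an Erlang density divided by the rate: this form also covers \<open>a < 0\<close>, where both sides
  vanish. It is the difference of two consecutive Erlang distribution functions, in which all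
  terms but the last cancel; for empty \<open>B\<close> the first of them is replaced by the constant \<open>1\<close>.
\<close>
lemma (in prob_space) prob_exponential_sums_straddle:
  fixes X :: "nat \<Rightarrow> 'a \<Rightarrow> real"
  assumes indep: "indep_vars (\<lambda>_. borel) X (insert k B)" and "finite B" "k \<notin> B" and b: "0 < b"
    and X: "\<And>i. i \<in> insert k B \<Longrightarrow> distributed M lborel (X i) (exponential_density b)"
  shows "prob {\<omega> \<in> space M. (\<Sum>i\<in>B. X i \<omega>) \<le> a \<and> a < (\<Sum>i\<in>B. X i \<omega>) + X k \<omega>} =
    erlang_density (card B) b a / b"
proof -
  let ?V = "\<lambda>\<omega>. \<Sum>i\<in>B. X i \<omega>" and ?W = "\<lambda>\<omega>. \<Sum>i\<in>insert k B. X i \<omega>"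
  have [measurable]: "random_variable borel (X i)" if "i \<in> insert k B" for i
    using distributed_measurable[OF X[OF that]] by simp
  have Xk[measurable]: "random_variable borel (X k)" by measurable
  have V[measurable]: "random_variable borel ?V" by (rule borel_measurable_sum) auto
  have W: "?W \<omega> = ?V \<omega> + X k \<omega>" for \<omega>
    using \<open>finite B\<close> \<open>k \<notin> B\<close> by simp
  have pos: "AE \<omega> in M. 0 < X i \<omega>" if "i \<in> insert k B" for i
    by (rule AE_exponential_pos[OF X[OF that] b])
  have Wd: "distributed M lborel ?W (erlang_density (card B) b)"
    using exponential_distributed_sum[OF _ _ b X indep] assms by simp
  have CDF_W: "prob {\<omega> \<in> space M. ?V \<omega> + X k \<omega> \<le> a} = erlang_CDF (card B) b a" if "0 \<le> a"
    using erlang_distributed_le[OF Wd b that] unfolding W .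
  have CDF_V: "prob {\<omega> \<in> space M. ?V \<omega> \<le> a} =
      (if B = {} then 1 else erlang_CDF (card B - 1) b a)" if "0 \<le> a"
  proof (cases "B = {}")
    case True
    then show ?thesis using that by (simp add: prob_space)
  next
    case False
    then have "distributed M lborel ?V (erlang_density (card B - 1) b)"
      using assms by (intro exponential_distributed_sum indep_vars_subset[OF indep]) auto
    from erlang_distributed_le[OF this b that] False show ?thesis by simp
  qed
  show ?thesis
  proof (cases "0 \<le> a")
    case True
    have "prob {\<omega> \<in> space M. ?V \<omega> \<le> a \<and> a < ?V \<omega> + X k \<omega>} =
        prob ({\<omega> \<in> space M. ?V \<omega> \<le> a} - {\<omega> \<in> space M. ?V \<omega> + X k \<omega> \<le> a \<and> ?V \<omega> \<le> a})"
      by (intro arg_cong[where f=prob]) auto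
    also have "\<dots> = prob {\<omega> \<in> space M. ?V \<omega> \<le> a} - prob {\<omega> \<in> space M. ?V \<omega> + X k \<omega> \<le> a \<and> ?V \<omega> \<le> a}"
      by (rule finite_measure_Diff) auto
    also have "prob {\<omega> \<in> space M. ?V \<omega> + X k \<omega> \<le> a \<and> ?V \<omega> \<le> a} = prob {\<omega> \<in> space M. ?V \<omega> + X k \<omega> \<le> a}"
      using pos[of k] by (intro finite_measure_eq_AE) auto
    also have "prob {\<omega> \<in> space M. ?V \<omega> \<le> a} - \<dots> = (b * a) ^ card B * exp (- b * a) / fact (card B)"
    proof (cases "card B")
      case 0
      then have "B = {}" using \<open>finite B\<close> by simp
      then show ?thesis using CDF_W[OF True] CDF_V[OF True] True by (simp add: erlang_CDF_def)
    next
      case (Suc n)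
      then have "B \<noteq> {}" by auto
      then show ?thesis using Suc CDF_W[OF True] CDF_V[OF True] True by (simp add: erlang_CDF_def)
    qed
    also have "\<dots> = erlang_density (card B) b a / b"
      using True b by (simp add: erlang_density_def power_mult_distrib)
    finally show ?thesis .
  next
    case False
    have "AE \<omega> in M. \<forall>i\<in>B. 0 < X i \<omega>"
      using \<open>finite B\<close> pos by (intro AE_finite_allI) auto
    then have "AE \<omega> in M. \<not> (?V \<omega> \<le> a \<and> a < ?V \<omega> + X k \<omega>)"
    proof eventually_elim
      case (elim \<omega>)
      have "0 \<le> ?V \<omega>" using elim by (intro sum_nonneg) (auto intro: less_imp_le)
      then show ?case using False by linarith
    qed
    then have "emeasure M {\<omega> \<in> space M. ?V \<omega> \<le> a \<and> a < ?V \<omega> + X k \<omega>} = 0"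
      by (rule emeasure_eq_0_AE)
    then show ?thesis using False by (simp add: measure_def erlang_density_def)
  qed
qed

text \<open>
  The event is that the sum over \<open>B\<close> has not passed \<open>t - U\<close> but passes it when \<^term>\<open>X k\<close> is added,
  \<open>U\<close> being the sum over \<open>A\<close>. The families indexed by \<open>A\<close> and by \<open>insert k B\<close> are independent, so
  Fubini's theorem allows fixing \<open>U = q\<close>, and what remains is the Poisson probability at \<open>t - q\<close>.
\<close>
lemma (in prob_space) emeasure_interleaved_exponential_sums:
  fixes X :: "nat \<Rightarrow> 'a \<Rightarrow> real"
  assumes indep: "indep_vars (\<lambda>_. borel) X I"
    and AB: "finite A" "A \<noteq> {}" "finite B" "A \<inter> B = {}" "k \<notin> A" "k \<notin> B" "A \<subseteq> I" "B \<subseteq> I" "k \<in> I"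
    and a: "0 < a" "\<And>i. i \<in> A \<Longrightarrow> distributed M lborel (X i) (exponential_density a)"
    and b: "0 < b" "\<And>i. i \<in> insert k B \<Longrightarrow> distributed M lborel (X i) (exponential_density b)"
    and C[measurable]: "C \<in> sets borel"
  shows "emeasure M {\<omega> \<in> space M. (\<Sum>i\<in>A. X i \<omega>) \<in> C \<and> (\<Sum>i\<in>A. X i \<omega>) + (\<Sum>i\<in>B. X i \<omega>) \<le> t \<and>
        t < (\<Sum>i\<in>A. X i \<omega>) + (\<Sum>i\<in>B. X i \<omega>) + X k \<omega>} =
    (\<integral>\<^sup>+q. ennreal (erlang_density (card A - 1) a q * (erlang_density (card B) b (t - q) / b)) * indicator C q \<partial>lborel)"
proof -
  let ?U = "\<lambda>\<omega>. \<Sum>i\<in>A. X i \<omega>" and ?V = "\<lambda>\<omega>. \<Sum>i\<in>B. X i \<omega>"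
  let ?XA = "\<lambda>\<omega>. restrict (\<lambda>i. X i \<omega>) A" and ?XB = "\<lambda>\<omega>. restrict (\<lambda>i. X i \<omega>) (insert k B)"
  let ?PA = "PiM A (\<lambda>_. borel :: real measure)" and ?PB = "PiM (insert k B) (\<lambda>_. borel :: real measure)"
  let ?g = "\<lambda>q. ennreal (erlang_density (card B) b (t - q) / b) * indicator C q"
  define D where "D = {z \<in> space (?PA \<Otimes>\<^sub>M ?PB). (\<Sum>i\<in>A. fst z i) \<in> C \<and>
    (\<Sum>i\<in>A. fst z i) + (\<Sum>i\<in>B. snd z i) \<le> t \<and> t < (\<Sum>i\<in>A. fst z i) + (\<Sum>i\<in>B. snd z i) + snd z k}"
  have [measurable]: "(\<lambda>z. fst z i) \<in> borel_measurable (?PA \<Otimes>\<^sub>M ?PB)" if "i \<in> A" for i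
    using that by (intro measurable_compose[OF measurable_fst] measurable_component_singleton)
  have [measurable]: "(\<lambda>z. snd z i) \<in> borel_measurable (?PA \<Otimes>\<^sub>M ?PB)" if "i \<in> insert k B" for i
    using that by (intro measurable_compose[OF measurable_snd] measurable_component_singleton)
  have [measurable]: "(\<lambda>z. \<Sum>i\<in>A. fst z i) \<in> borel_measurable (?PA \<Otimes>\<^sub>M ?PB)"
    "(\<lambda>z. \<Sum>i\<in>B. snd z i) \<in> borel_measurable (?PA \<Otimes>\<^sub>M ?PB)"
    "(\<lambda>z. snd z k) \<in> borel_measurable (?PA \<Otimes>\<^sub>M ?PB)"
    by (auto intro!: borel_measurable_sum)
  have D[measurable]: "D \<in> sets (?PA \<Otimes>\<^sub>M ?PB)" unfolding D_def by measurable
  \<comment> \<open>The independent pair consists of the restricted families, not of the sums: the two components must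
    have the same type, and the second one has to carry both the sum over \<open>B\<close> and \<open>X k\<close>.\<close>
  have ind: "indep_var ?PA ?XA ?PB ?XB"
    using AB by (intro indep_var_restrict[OF indep]) auto
  have [measurable]: "?XA \<in> M \<rightarrow>\<^sub>M ?PA" "?XB \<in> M \<rightarrow>\<^sub>M ?PB"
    using ind by (auto dest: indep_var_rv1 indep_var_rv2)
  have XA: "?XA \<omega> \<in> space ?PA" for \<omega> by (simp add: space_PiM PiE_def)
  have XB: "?XB \<omega> \<in> space ?PB" for \<omega> by (simp add: space_PiM PiE_def)
  interpret XB: prob_space "distr M ?PB ?XB" by (rule prob_space_distr) simp
  have Ud: "distributed M lborel ?U (erlang_density (card A - 1) a)"
    using AB a by (intro exponential_distributed_sum indep_vars_subset[OF indep]) auto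
  have "emeasure M {\<omega> \<in> space M. ?U \<omega> \<in> C \<and> ?U \<omega> + ?V \<omega> \<le> t \<and> t < ?U \<omega> + ?V \<omega> + X k \<omega>} =
      emeasure M ((\<lambda>\<omega>. (?XA \<omega>, ?XB \<omega>)) -` D \<inter> space M)"
    using XA XB by (intro arg_cong[where f="emeasure M"]) (auto simp: D_def space_pair_measure)
  also have "\<dots> = emeasure (distr M (?PA \<Otimes>\<^sub>M ?PB) (\<lambda>\<omega>. (?XA \<omega>, ?XB \<omega>))) D"
    by (rule emeasure_distr[symmetric]) measurable
  also have "\<dots> = emeasure (distr M ?PA ?XA \<Otimes>\<^sub>M distr M ?PB ?XB) D"
    using ind unfolding indep_var_distribution_eq by simp
  also have "\<dots> = (\<integral>\<^sup>+u. emeasure (distr M ?PB ?XB) (Pair u -` D) \<partial>distr M ?PA ?XA)"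
    by (rule XB.emeasure_pair_measure_alt) simp
  also have "\<dots> = (\<integral>\<^sup>+u. ?g (\<Sum>i\<in>A. u i) \<partial>distr M ?PA ?XA)"
  proof (rule nn_integral_cong)
    fix u assume "u \<in> space (distr M ?PA ?XA)"
    then have u: "u \<in> space ?PA" by simp
    let ?q = "\<Sum>i\<in>A. u i"
    have "emeasure (distr M ?PB ?XB) (Pair u -` D) = emeasure M (?XB -` (Pair u -` D) \<inter> space M)"
      using sets_Pair1[OF D] by (intro emeasure_distr) auto
    also have "?XB -` (Pair u -` D) \<inter> space M =
        (if ?q \<in> C then {\<omega> \<in> space M. ?V \<omega> \<le> t - ?q \<and> t - ?q < ?V \<omega> + X k \<omega>} else {})"
      using u XB by (auto simp: D_def space_pair_measure)
    also have "emeasure M \<dots> = ?g ?q"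
    proof -
      have "prob {\<omega> \<in> space M. ?V \<omega> \<le> t - ?q \<and> t - ?q < ?V \<omega> + X k \<omega>} = erlang_density (card B) b (t - ?q) / b"
        using AB b by (intro prob_exponential_sums_straddle indep_vars_subset[OF indep]) auto
      then show ?thesis by (simp add: emeasure_eq_measure)
    qed
    finally show "emeasure (distr M ?PB ?XB) (Pair u -` D) = ?g ?q" .
  qed
  also have "\<dots> = (\<integral>\<^sup>+\<omega>. ?g (?U \<omega>) \<partial>M)"
    by (subst nn_integral_distr) (auto intro!: measurable_compose[where N=borel] borel_measurable_sum cong: sum.cong)
  also have "\<dots> = (\<integral>\<^sup>+q. ennreal (erlang_density (card A - 1) a q) * ?g q \<partial>lborel)"
    by (rule distributed_nn_integral[OF Ud, symmetric]) measurable
  also have "\<dots> = (\<integral>\<^sup>+q. ennreal (erlang_density (card A - 1) a q * (erlang_density (card B) b (t - q) / b)) * indicator C q \<partial>lborel)"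
    using a(1) b(1) by (intro nn_integral_cong, subst ennreal_mult) (simp_all add: mult.assoc)
  finally show ?thesis .
qed


section \<open>Densities and Bessel series\<close>

text \<open>
  The defining series with its Gamma values written as factorials; it is dominated by an
  exponential series.
\<close>
lemma bessel_I_sums:
  "(\<lambda>m. (\<xi> / 2) ^ (\<nu> + 2 * m) / (fact m * fact (\<nu> + m))) sums bessel_I \<nu> \<xi>"
proof -
  have "summable (\<lambda>m. \<bar>\<xi> / 2\<bar> ^ \<nu> * (inverse (fact m) * ((\<xi> / 2)\<^sup>2) ^ m))"
    by (intro summable_mult summable_exp)
  then have "summable (\<lambda>m. (\<xi> / 2) ^ (\<nu> + 2 * m) / (fact m * fact (\<nu> + m)))"
  proof (rule summable_comparison_test')
    fix m :: nat
    have "(1::real) \<le> fact (\<nu> + m)" by (rule fact_ge_1)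
    then have "\<bar>\<xi> / 2\<bar> ^ (\<nu> + 2 * m) / (fact m * fact (\<nu> + m)) \<le> \<bar>\<xi> / 2\<bar> ^ (\<nu> + 2 * m) / (fact m * 1)"
      by (intro divide_left_mono mult_left_mono) auto
    also have "\<dots> = \<bar>\<xi> / 2\<bar> ^ \<nu> * (inverse (fact m) * ((\<xi> / 2)\<^sup>2) ^ m)"
    proof -
      have "\<bar>\<xi> / 2\<bar> ^ (\<nu> + 2 * m) = \<bar>\<xi> / 2\<bar> ^ \<nu> * ((\<xi> / 2)\<^sup>2) ^ m"
        by (simp only: power_add power_mult power2_abs)
      then show ?thesis by (simp only: divide_inverse mult_1_left mult_1_right mult_ac)
    qed
    finally show "norm ((\<xi> / 2) ^ (\<nu> + 2 * m) / (fact m * fact (\<nu> + m))) \<le>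
        \<bar>\<xi> / 2\<bar> ^ \<nu> * (inverse (fact m) * ((\<xi> / 2)\<^sup>2) ^ m)"
      by (simp add: abs_mult power_abs)
  qed
  moreover have "Gamma (real \<nu> + real m + 1) = fact (\<nu> + m)" for m
    using Gamma_fact[of "\<nu> + m", where 'a=real] by (simp add: add_ac)
  ultimately show ?thesis by (simp add: bessel_I_def summable_sums)
qed

lemma borel_measurable_bessel_I[measurable]: "bessel_I \<nu> \<in> borel_measurable borel"
  unfolding bessel_I_def by measurable

text \<open>
  For \<open>n \<ge> 1\<close>, the density at \<open>x\<close> of the position at time \<open>t\<close> on the event of exactly \<open>n\<close> jumps.
  Its arguments \<open>(t + x) / 2\<close> and \<open>(t - x) / 2\<close> are the times spent with velocity \<open>+1\<close> and \<open>-1\<close>.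
  The factor that is divided by its rate is the Poisson probability belonging to the parity of the
  unfinished waiting time, and \<open>1 / 2\<close> is the Jacobian of the passage from a time to a position.
\<close>
definition position_density :: "real \<Rightarrow> real \<Rightarrow> real \<Rightarrow> nat \<Rightarrow> real \<Rightarrow> real" where
  "position_density c0 c1 t n x =
    (if odd n then erlang_density (n div 2) c0 ((t + x) / 2) * (erlang_density (n div 2) c1 ((t - x) / 2) / c1) / 2
     else erlang_density (n div 2 - 1) c1 ((t - x) / 2) * (erlang_density (n div 2) c0 ((t + x) / 2) / c0) / 2)"

lemma position_density_nonneg: "0 < c0 \<Longrightarrow> 0 < c1 \<Longrightarrow> 0 \<le> position_density c0 c1 t n x"
  by (simp add: position_density_def)

lemma borel_measurable_position_density[measurable]: "position_density c0 c1 t n \<in> borel_measurable borel"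
  unfolding position_density_def by measurable

lemma position_density_outside: "x \<notin> {-t..t} \<Longrightarrow> position_density c0 c1 t n x = 0"
  by (auto simp: position_density_def erlang_density_def)

text \<open>
  The point \<open>x = t\<close> is excluded: there the square root contains a division by zero, which returns
  \<open>0\<close>, whereas the density for \<open>n = 2\<close> does not vanish.
\<close>
lemma position_density_sums:
  assumes c: "0 < c0" "0 < c1" and x: "- t \<le> x" "x < t"
  shows "(\<lambda>n. position_density c0 c1 t (Suc n) x) sums
    (exp (- ((c0 + c1) / 2) * t) * (1 / 2 *
      (sqrt (c0 * c1 * (t + x) / (t - x)) * bessel_I 1 (sqrt (c0 * c1 * (t\<^sup>2 - x\<^sup>2)))
        + c0 * bessel_I 0 (sqrt (c0 * c1 * (t\<^sup>2 - x\<^sup>2)))) * exp ((c1 - c0) / 2 * x)))"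
proof -
  define p q where "p = (t + x) / 2" and "q = (t - x) / 2"
  have pq: "0 \<le> p" "0 < q" using x by (auto simp: p_def q_def)
  define \<xi> where "\<xi> = sqrt (c0 * c1 * (t\<^sup>2 - x\<^sup>2))"
  define r where "r = sqrt (c0 * c1 * (t + x) / (t - x))"
  define E where "E = exp (- c0 * p) * exp (- c1 * q)"
  have tx: "t\<^sup>2 - x\<^sup>2 = 4 * (p * q)" by (simp add: p_def q_def power2_eq_square field_simps)
  have \<xi>: "\<xi> / 2 = sqrt (c0 * c1 * p * q)"
    unfolding \<xi>_def tx by (simp add: real_sqrt_mult mult_ac)
  have \<xi>2: "(\<xi> / 2)\<^sup>2 = c0 * c1 * p * q" unfolding \<xi> using c pq by simp
  have r_eq: "r = sqrt (c0 * c1 * p / q)" by (simp add: r_def p_def q_def)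
  \<comment> \<open>This supplies the one factor by which the powers of \<open>p\<close> exceed those of \<open>q\<close> for even \<open>n\<close>.\<close>
  have r: "r * (\<xi> / 2) = c0 * c1 * p"
  proof -
    have "c0 * c1 * p / q * (c0 * c1 * p * q) = (c0 * c1 * p)\<^sup>2"
      using pq by (simp add: power2_eq_square)
    then show ?thesis
      unfolding \<xi> r_eq real_sqrt_mult[symmetric] using c pq by simp
  qed
  have E: "exp (- ((c0 + c1) / 2) * t) * exp ((c1 - c0) / 2 * x) = E"
    unfolding E_def exp_add[symmetric] by (simp add: p_def q_def field_simps)
  have "(\<lambda>m. E * (1 / 2 * (c0 * ((\<xi> / 2) ^ (0 + 2 * m) / (fact m * fact (0 + m)))))) sums
      (E * (1 / 2 * (c0 * bessel_I 0 \<xi>)))"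
    by (intro sums_mult bessel_I_sums)
  moreover have "E * (1 / 2 * (c0 * ((\<xi> / 2) ^ (0 + 2 * m) / (fact m * fact (0 + m))))) =
      position_density c0 c1 t (Suc (2 * m)) x" for m
    unfolding position_density_def p_def[symmetric] q_def[symmetric] power_add power_mult \<xi>2
    using pq c by (simp add: erlang_density_def E_def power_mult_distrib mult_ac)
  ultimately have odd: "(\<lambda>m. position_density c0 c1 t (Suc (2 * m)) x) sums (E * (1 / 2 * (c0 * bessel_I 0 \<xi>)))"
    by simp
  have "(\<lambda>m. E * (1 / 2 * (r * ((\<xi> / 2) ^ (1 + 2 * m) / (fact m * fact (1 + m)))))) sums
      (E * (1 / 2 * (r * bessel_I 1 \<xi>)))"
    by (intro sums_mult bessel_I_sums)
  moreover have "E * (1 / 2 * (r * ((\<xi> / 2) ^ (1 + 2 * m) / (fact m * fact (1 + m))))) =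
      position_density c0 c1 t (Suc (2 * m + 1)) x" for m
  proof -
    have "r * (\<xi> / 2) ^ (1 + 2 * m) = c0 * c1 * p * (c0 * c1 * p * q) ^ m"
      unfolding power_add power_mult \<xi>2 using r by simp
    then have "E * (1 / 2 * (r * ((\<xi> / 2) ^ (1 + 2 * m) / (fact m * fact (1 + m))))) =
        E * (1 / 2 * (c0 * c1 * p * (c0 * c1 * p * q) ^ m / (fact m * fact (1 + m))))"
      by (simp only: times_divide_eq_right)
    also have "\<dots> = position_density c0 c1 t (Suc (2 * m + 1)) x"
      unfolding position_density_def p_def[symmetric] q_def[symmetric]
      using pq c by (simp add: erlang_density_def E_def power_mult_distrib mult_ac del: fact_Suc)
    finally show ?thesis .
  qed
  ultimately have even: "(\<lambda>m. position_density c0 c1 t (Suc (2 * m + 1)) x) sums (E * (1 / 2 * (r * bessel_I 1 \<xi>)))"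
    by simp
  \<comment> \<open>Interleaving: the series is indexed by \<open>n - 1\<close>, so its even terms are those with \<open>n\<close> odd.\<close>
  from sums_if[OF even odd]
  have "(\<lambda>n. if even n then position_density c0 c1 t (Suc (2 * (n div 2))) x
        else position_density c0 c1 t (Suc (2 * ((n - 1) div 2) + 1)) x) sums
      (E * (1 / 2 * (r * bessel_I 1 \<xi>)) + E * (1 / 2 * (c0 * bessel_I 0 \<xi>)))"
    by simp
  also have "(\<lambda>n. if even n then position_density c0 c1 t (Suc (2 * (n div 2))) x
        else position_density c0 c1 t (Suc (2 * ((n - 1) div 2) + 1)) x) = (\<lambda>n. position_density c0 c1 t (Suc n) x)"
    by (auto simp: fun_eq_iff elim!: oddE)
  also have "E * (1 / 2 * (r * bessel_I 1 \<xi>)) + E * (1 / 2 * (c0 * bessel_I 0 \<xi>)) =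
      exp (- ((c0 + c1) / 2) * t) * (1 / 2 * (r * bessel_I 1 \<xi> + c0 * bessel_I 0 \<xi>) * exp ((c1 - c0) / 2 * x))"
    unfolding E[symmetric] by (simp add: algebra_simps)
  finally show ?thesis unfolding r_def \<xi>_def .
qed

section \<open>The law on each number of jumps\<close>

lemma nn_integral_density_affine:
  fixes d g :: "real \<Rightarrow> real"
  assumes [measurable]: "d \<in> borel_measurable borel" "C \<in> sets borel"
    and s: "s \<noteq> 0" and d: "\<And>x. 0 \<le> d x" and g: "\<And>q. g q = \<bar>s\<bar> * d (r + s * q)"
  shows "(\<integral>\<^sup>+q. ennreal (g q) * indicator {q. r + s * q \<in> C} q \<partial>lborel) =
    (\<integral>\<^sup>+x. ennreal (d x) * indicator C x \<partial>lborel)"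
proof -
  have "(\<integral>\<^sup>+x. ennreal (d x) * indicator C x \<partial>lborel) =
      ennreal \<bar>s\<bar> * (\<integral>\<^sup>+q. ennreal (d (r + s * q)) * indicator C (r + s * q) \<partial>lborel)"
    using s by (intro nn_integral_real_affine) auto
  also have "\<dots> = (\<integral>\<^sup>+q. ennreal \<bar>s\<bar> * (ennreal (d (r + s * q)) * indicator C (r + s * q)) \<partial>lborel)"
    by (rule nn_integral_cmult[symmetric]) measurable
  also have "\<dots> = (\<integral>\<^sup>+q. ennreal (g q) * indicator {q. r + s * q \<in> C} q \<partial>lborel)"
    using d by (intro nn_integral_cong) (simp add: g ennreal_mult mult.assoc indicator_def)
  finally show ?thesis ..
qed

text \<open>
  For odd \<open>n\<close> the position is the affine image \<open>2U - t\<close> of the odd time \<open>U\<close>, and the next jump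
  ends an even waiting time; for even \<open>n\<close> it is \<open>t - 2V\<close> and the next jump ends an odd one. In
  both cases the slope \<open>\<plusminus>2\<close> produces the factor \<open>1/2\<close> of the density.
\<close>
lemma (in prob_space) emeasure_position_after_jumps:
  fixes X :: "nat \<Rightarrow> 'a \<Rightarrow> real"
  assumes indep: "indep_vars (\<lambda>_. borel) X {1..}"
    and X: "\<And>i. 1 \<le> i \<Longrightarrow> distributed M lborel (X i) (exponential_density (if odd i then c0 else c1))"
    and c: "0 < c0" "0 < c1" and C[measurable]: "C \<in> sets borel" and n: "1 \<le> n"
  shows "emeasure M {\<omega> \<in> space M. position (\<lambda>i. X i \<omega>) n t \<in> C \<and>
      (\<Sum>i=1..n. X i \<omega>) \<le> t \<and> t < (\<Sum>i=1..Suc n. X i \<omega>)} =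
    (\<integral>\<^sup>+x. ennreal (position_density c0 c1 t n x) * indicator C x \<partial>lborel)"
proof -
  let ?O = "{i. i \<in> {1..n} \<and> odd i}" and ?E = "{i. i \<in> {1..n} \<and> even i}"
  note interleaved = emeasure_interleaved_exponential_sums[OF indep, where k="Suc n" and t=t]
  note d = borel_measurable_position_density[of c0 c1 t n] C
  have half_diff: "(2 * t - 2 * q) / 2 = t - q" for q :: real by simp
  have half: "{q. r + s * q \<in> C} \<in> sets borel" for r s :: real
  proof -
    have "(\<lambda>q. r + s * q) -` C \<inter> space borel \<in> sets borel" by measurable
    then show ?thesis by (simp add: vimage_def)
  qed
  show ?thesis
  proof (cases "odd n")
    case True
    have card: "card ?O - 1 = n div 2" "card ?E = n div 2"
      unfolding card_odd_indices card_even_indices using True by (auto elim: oddE)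
    have ne: "?O \<noteq> {}" using True n by auto
    have "emeasure M {\<omega> \<in> space M. position (\<lambda>i. X i \<omega>) n t \<in> C \<and>
        (\<Sum>i=1..n. X i \<omega>) \<le> t \<and> t < (\<Sum>i=1..Suc n. X i \<omega>)} =
      emeasure M {\<omega> \<in> space M. (\<Sum>i\<in>?O. X i \<omega>) \<in> {q. - t + 2 * q \<in> C} \<and>
        (\<Sum>i\<in>?O. X i \<omega>) + (\<Sum>i\<in>?E. X i \<omega>) \<le> t \<and> t < (\<Sum>i\<in>?O. X i \<omega>) + (\<Sum>i\<in>?E. X i \<omega>) + X (Suc n) \<omega>}"
      unfolding odd_time_def[symmetric] even_time_def[symmetric] sum_eq_odd_time_plus_even_time position_def
      using True by (simp add: odd_time_Suc even_time_Suc add_ac)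
    also have "\<dots> = (\<integral>\<^sup>+q. ennreal (erlang_density (n div 2) c0 q * (erlang_density (n div 2) c1 (t - q) / c1)) *
        indicator {q. - t + 2 * q \<in> C} q \<partial>lborel)"
    proof (subst interleaved[of ?O ?E c0 c1], unfold card)
      show "distributed M lborel (X i) (exponential_density c0)" if "i \<in> ?O" for i
        using X[of i] that by simp
      show "distributed M lborel (X i) (exponential_density c1)" if "i \<in> insert (Suc n) ?E" for i
        using X[of i] that True by (cases "i = Suc n") auto
    qed (use ne c half in auto)
    also have "\<dots> = (\<integral>\<^sup>+x. ennreal (position_density c0 c1 t n x) * indicator C x \<partial>lborel)"
      using True by (intro nn_integral_density_affine d position_density_nonneg c) (simp_all add: position_density_def half_diff)
    finally show ?thesis .
  next
    case False
    have card: "card ?E - 1 = n div 2 - 1" "card ?O = n div 2"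
      unfolding card_odd_indices card_even_indices using False by auto
    have "2 \<in> ?E" using False n by (auto elim!: evenE)
    then have ne: "?E \<noteq> {}" by blast
    have "emeasure M {\<omega> \<in> space M. position (\<lambda>i. X i \<omega>) n t \<in> C \<and>
        (\<Sum>i=1..n. X i \<omega>) \<le> t \<and> t < (\<Sum>i=1..Suc n. X i \<omega>)} =
      emeasure M {\<omega> \<in> space M. (\<Sum>i\<in>?E. X i \<omega>) \<in> {q. t + (- 2) * q \<in> C} \<and>
        (\<Sum>i\<in>?E. X i \<omega>) + (\<Sum>i\<in>?O. X i \<omega>) \<le> t \<and> t < (\<Sum>i\<in>?E. X i \<omega>) + (\<Sum>i\<in>?O. X i \<omega>) + X (Suc n) \<omega>}"
      unfolding odd_time_def[symmetric] even_time_def[symmetric] sum_eq_odd_time_plus_even_time position_def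
      using False by (simp add: odd_time_Suc even_time_Suc add_ac)
    also have "\<dots> = (\<integral>\<^sup>+q. ennreal (erlang_density (n div 2 - 1) c1 q * (erlang_density (n div 2) c0 (t - q) / c0)) *
        indicator {q. t + (- 2) * q \<in> C} q \<partial>lborel)"
    proof (subst interleaved[of ?E ?O c1 c0], unfold card)
      show "distributed M lborel (X i) (exponential_density c1)" if "i \<in> ?E" for i
        using X[of i] that by simp
      show "distributed M lborel (X i) (exponential_density c0)" if "i \<in> insert (Suc n) ?O" for i
        using X[of i] that False by (cases "i = Suc n") auto
    qed (use ne c half in auto)
    also have "\<dots> = (\<integral>\<^sup>+x. ennreal (position_density c0 c1 t n x) * indicator C x \<partial>lborel)"
      using False by (intro nn_integral_density_affine d position_density_nonneg c) (simp_all add: position_density_def half_diff)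
    finally show ?thesis .
  qed
qed

lemma (in prob_space) emeasure_position_before_jumps:
  fixes X :: "nat \<Rightarrow> 'a \<Rightarrow> real"
  assumes X: "distributed M lborel (X 1) (exponential_density c0)" and "0 < c0" "0 \<le> t"
  shows "emeasure M {\<omega> \<in> space M. position (\<lambda>i. X i \<omega>) 0 t \<in> C \<and>
      (\<Sum>i=1..0. X i \<omega>) \<le> t \<and> t < (\<Sum>i=1..Suc 0. X i \<omega>)} = ennreal (exp (- c0 * t)) * indicator C t"
proof -
  have "{\<omega> \<in> space M. position (\<lambda>i. X i \<omega>) 0 t \<in> C \<and> (\<Sum>i=1..0. X i \<omega>) \<le> t \<and> t < (\<Sum>i=1..Suc 0. X i \<omega>)} =
      (if t \<in> C then {\<omega> \<in> space M. t < X 1 \<omega>} else {})"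
    using \<open>0 \<le> t\<close> by (auto simp: position_def even_time_def)
  then show ?thesis
    using exponential_distributedD_gt[OF X \<open>0 \<le> t\<close> \<open>0 < c0\<close>] by (simp add: emeasure_eq_measure mult.commute)
qed

text \<open>
  The subtracted sum is a partial sum of the exponential series times \<open>exp (- l a)\<close>, hence tends
  to \<open>1\<close>.
\<close>
lemma erlang_CDF_tendsto_0: "(\<lambda>n. erlang_CDF n l a) \<longlonglongrightarrow> 0"
proof (cases "a < 0")
  case False
  have "(\<lambda>n. (l * a) ^ n /\<^sub>R fact n) sums exp (l * a)" by (rule exp_converges)
  then have "(\<lambda>n. \<Sum>k\<le>n. (l * a) ^ k /\<^sub>R fact k) \<longlonglongrightarrow> exp (l * a)"
    by (simp add: sums_def_le)
  then have "(\<lambda>n. 1 - (\<Sum>k\<le>n. (l * a) ^ k /\<^sub>R fact k) * exp (- l * a)) \<longlonglongrightarrow> 1 - exp (l * a) * exp (- l * a)"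
    by (intro tendsto_intros)
  moreover have "exp (l * a) * exp (- l * a) = 1" by (simp add: exp_minus)
  moreover have "erlang_CDF n l a = 1 - (\<Sum>k\<le>n. (l * a) ^ k /\<^sub>R fact k) * exp (- l * a)" for n
    using False unfolding erlang_CDF_def sum_distrib_right by (simp add: divide_inverse mult_ac)
  ultimately show ?thesis by simp
qed (simp add: erlang_CDF_def)

text \<open>
  The sum of the odd waiting times alone exceeds \<open>t\<close>: the probability that \<open>n + 1\<close> of them sum to
  at most \<open>t\<close> is an Erlang distribution function, which tends to \<open>0\<close> as \<open>n\<close> grows.
\<close>
lemma (in prob_space) AE_finitely_many_jumps:
  fixes X :: "nat \<Rightarrow> 'a \<Rightarrow> real"
  assumes indep: "indep_vars (\<lambda>_. borel) X {1..}"
    and X: "\<And>i. 1 \<le> i \<Longrightarrow> distributed M lborel (X i) (exponential_density (if odd i then c0 else c1))"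
    and c: "0 < c0" "0 < c1" and t: "0 \<le> t"
  shows "AE \<omega> in M. \<exists>n. t < (\<Sum>i=1..n. X i \<omega>)"
proof -
  have [measurable]: "random_variable borel (X i)" if "1 \<le> i" for i
    using distributed_measurable[OF X[OF that]] by simp
  have [measurable]: "random_variable borel (\<lambda>\<omega>. \<Sum>i=1..n. X i \<omega>)" for n
    by (rule borel_measurable_sum) auto
  have pos: "AE \<omega> in M. \<forall>i. 1 \<le> i \<longrightarrow> 0 < X i \<omega>"
    using c by (intro AE_exponentials_pos[OF X]) auto
  let ?A = "{\<omega> \<in> space M. \<forall>n. (\<Sum>i=1..n. X i \<omega>) \<le> t}"
  have A[measurable]: "?A \<in> events" by measurable
  have "prob ?A \<le> erlang_CDF n c0 t" for n
  proof -
    \<comment> \<open>The first \<open>n + 1\<close> odd indices.\<close>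
    let ?I = "{i. i \<in> {1..Suc (2 * n)} \<and> odd i}"
    have ne: "?I \<noteq> {}" by (auto intro!: exI[of _ 1])
    have D: "distributed M lborel (\<lambda>\<omega>. \<Sum>i\<in>?I. X i \<omega>) (erlang_density (card ?I - 1) c0)"
      by (rule exponential_distributed_sum[OF _ ne c(1) _ indep_vars_subset[OF indep]]) (use X in force)+
    have [measurable]: "random_variable borel (\<lambda>\<omega>. \<Sum>i\<in>?I. X i \<omega>)"
      using distributed_measurable[OF D] by simp
    have "prob ?A \<le> prob {\<omega> \<in> space M. (\<Sum>i\<in>?I. X i \<omega>) \<le> t}"
    proof (rule finite_measure_mono_AE)
      show "AE \<omega> in M. \<omega> \<in> ?A \<longrightarrow> \<omega> \<in> {\<omega> \<in> space M. (\<Sum>i\<in>?I. X i \<omega>) \<le> t}"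
        using pos
      proof eventually_elim
        case (elim \<omega>)
        have "(\<Sum>i\<in>?I. X i \<omega>) \<le> (\<Sum>i=1..Suc (2 * n). X i \<omega>)"
          using elim by (intro sum_mono2) (auto intro: less_imp_le)
        then show ?case by (blast intro: order_trans)
      qed
    qed measurable
    also have "\<dots> = erlang_CDF n c0 t"
      using erlang_distributed_le[OF D c(1) t] by (simp only: card_odd_indices) simp
    finally show ?thesis .
  qed
  then have "prob ?A \<le> 0"
    by (intro LIMSEQ_le_const[OF erlang_CDF_tendsto_0]) auto
  then have "prob ?A = 0" by (simp add: measure_le_0_iff)
  then have "AE \<omega> in M. \<omega> \<notin> ?A"
    using prob_eq_0[OF A] by simp
  then show ?thesis by (auto simp: not_le elim!: eventually_mono)
qed

section \<open>The law of the telegraph process\<close>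

theorem proposition3p3:
  fixes M :: "'a measure" and e :: "nat \<Rightarrow> 'a \<Rightarrow> real"
    and c0 c1 \<tau> \<tau>' t :: real and f :: "real \<Rightarrow> real \<Rightarrow> real"
  assumes "prob_space M" and "iid_unit_exponential M e"
    and "c0 > 0" and "c1 > 0" and "t > 0"
    and "\<tau> = (c0 + c1) / 2" and "\<tau>' = (c1 - c0) / 2"
    and "\<And>s x. f s x =
           1 / 2 * (sqrt (c0 * c1 * (s + x) / (s - x)) * bessel_I 1 (sqrt (c0 * c1 * (s\<^sup>2 - x\<^sup>2)))
                    + c0 * bessel_I 0 (sqrt (c0 * c1 * (s\<^sup>2 - x\<^sup>2)))) * exp (\<tau>' * x)"
  shows "telegraph c0 c1 e t \<in> borel_measurable M \<and>
    (\<forall>A\<in>sets borel.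
       emeasure (distr M borel (telegraph c0 c1 e t)) A =
         ennreal (exp (- c0 * t)) * emeasure (return borel t) A
         + emeasure (density lborel (\<lambda>x. ennreal (exp (- \<tau> * t) * f t x * indicator {-t..t} x))) A)"
proof (intro conjI ballI)
  note f_eq = assms(8)
  interpret prob_space M by fact
  have e_indep: "indep_vars (\<lambda>_. borel) e {1..}"
    and e_dist: "\<And>n. 1 \<le> n \<Longrightarrow> distributed M lborel (e n) (exponential_density 1)"
    using assms(2) by (auto simp: iid_unit_exponential_def)
  define X where "X i \<omega> = waiting_scale c0 c1 i * e i \<omega>" for i \<omega>
  let ?\<sigma> = "\<lambda>\<omega> n. \<Sum>i=1..n. X i \<omega>"
  have X_indep: "indep_vars (\<lambda>_. borel) X {1..}"
    unfolding X_def by (rule indep_vars_compose2[OF e_indep]) simp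
  have X_dist: "distributed M lborel (X i) (exponential_density (if odd i then c0 else c1))" if "1 \<le> i" for i
  proof -
    have "1 / waiting_scale c0 c1 i = (if odd i then c0 else c1)" "0 < waiting_scale c0 c1 i"
      using assms(3,4) by (simp_all add: waiting_scale_def)
    then show ?thesis
      using erlang_distributed_mult_const[OF e_dist[OF that], of "waiting_scale c0 c1 i"]
      unfolding X_def by simp
  qed
  have X_meas[measurable]: "X i \<in> borel_measurable M" if "1 \<le> i" for i
    using distributed_measurable[OF X_dist[OF that]] by simp
  have [measurable]: "(\<lambda>\<omega>. ?\<sigma> \<omega> n) \<in> borel_measurable M" for n
    by (rule borel_measurable_sum) auto
  have [measurable]: "(\<lambda>\<omega>. position (\<lambda>i. X i \<omega>) n t) \<in> borel_measurable M" for n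
    unfolding position_def odd_time_def even_time_def
    by (cases "even n"; simp; intro borel_measurable_diff borel_measurable_times borel_measurable_sum; simp)
  show Z[measurable]: "telegraph c0 c1 e t \<in> borel_measurable M"
    using distributed_measurable[OF e_dist] by (intro borel_measurable_telegraph) simp

  fix A :: "real set" assume A[measurable]: "A \<in> sets borel"
  define E where "E n = {\<omega> \<in> space M. position (\<lambda>i. X i \<omega>) n t \<in> A \<and> ?\<sigma> \<omega> n \<le> t \<and> t < ?\<sigma> \<omega> (Suc n)}" for n
  have E[measurable]: "E n \<in> events" for n unfolding E_def by measurable
  have pos: "AE \<omega> in M. \<forall>i. 1 \<le> i \<longrightarrow> 0 < X i \<omega>"
    using assms(3,4) by (intro AE_exponentials_pos[OF X_dist]) auto
  have finite_jumps: "AE \<omega> in M. \<exists>n. t < ?\<sigma> \<omega> n"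
    by (rule AE_finitely_many_jumps[OF X_indep X_dist assms(3,4)]) (use assms(5) in auto)
  \<comment> \<open>The events of exactly \<open>n\<close> jumps are disjoint and exhaustive only almost surely, so the decomposition
    is made for indicator functions.\<close>
  have split: "AE \<omega> in M. indicator {\<omega> \<in> space M. telegraph c0 c1 e t \<omega> \<in> A} \<omega> = (\<Sum>n. indicator (E n) \<omega> :: ennreal)"
    using pos finite_jumps AE_space
  proof eventually_elim
    case (elim \<omega>)
    then have X: "\<And>i. 1 \<le> i \<Longrightarrow> 0 < X i \<omega>" by blast
    have "\<exists>n. ?\<sigma> \<omega> n \<le> t \<and> t < ?\<sigma> \<omega> (Suc n)"
    proof -
      obtain N where "t < ?\<sigma> \<omega> N" using elim by blast
      moreover have "\<not> t < ?\<sigma> \<omega> 0" using assms(5) by simp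
      ultimately obtain k where k: "\<forall>i\<le>k. \<not> t < ?\<sigma> \<omega> i" "t < ?\<sigma> \<omega> (Suc k)"
        using ex_least_nat_less[of "\<lambda>n. t < ?\<sigma> \<omega> n" N] by blast
      then show ?thesis by (intro exI[of _ k]) (auto simp: not_less simp del: sum.cl_ivl_Suc)
    qed
    then obtain n where n: "?\<sigma> \<omega> n \<le> t" "t < ?\<sigma> \<omega> (Suc n)" by blast
    have "m = n" if "?\<sigma> \<omega> m \<le> t" "t < ?\<sigma> \<omega> (Suc m)" for m
      using partial_sums_below[OF X that] partial_sums_below[OF X n]
      by (metis card_atLeastAtMost diff_Suc_1)
    then have "indicator (E m) \<omega> = (0 :: ennreal)" if "m \<notin> {n}" for m
      using that by (auto simp: E_def indicator_def)
    then have "(\<Sum>m. indicator (E m) \<omega> :: ennreal) = indicator (E n) \<omega>"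
      by (subst suminf_finite[of "{n}"]) auto
    moreover have "telegraph c0 c1 e t \<omega> = position (\<lambda>i. X i \<omega>) n t"
      using X n unfolding X_def by (intro telegraph_eq_position) auto
    ultimately show ?case using n elim by (simp add: E_def indicator_def)
  qed
  let ?d = "\<lambda>x. ennreal (exp (- \<tau> * t) * f t x * indicator {-t..t} x)"
  have "(\<Sum>n. ennreal (position_density c0 c1 t (Suc n) x)) = ?d x" if "x \<noteq> t" for x
  proof (cases "x \<in> {-t..t}")
    case True
    then have x: "- t \<le> x" "x < t" using that by auto
    have "(\<lambda>n. position_density c0 c1 t (Suc n) x) sums (exp (- \<tau> * t) * f t x)"
      using position_density_sums[OF assms(3,4) x] unfolding f_eq assms(6,7) .
    then show ?thesis
      using True by (intro suminf_ennreal_eq position_density_nonneg assms) simp_all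
  next
    case False
    then show ?thesis by (simp add: position_density_outside)
  qed
  then have dens: "AE x in lborel. (\<Sum>n. ennreal (position_density c0 c1 t (Suc n) x)) = ?d x"
    using AE_lborel_singleton[of t] by (auto elim!: eventually_mono)
  have [measurable]: "f t \<in> borel_measurable borel" unfolding f_eq by measurable

  have "emeasure (distr M borel (telegraph c0 c1 e t)) A = emeasure M {\<omega> \<in> space M. telegraph c0 c1 e t \<omega> \<in> A}"
    by (subst emeasure_distr) (auto intro!: arg_cong[where f="emeasure M"])
  also have "\<dots> = (\<integral>\<^sup>+\<omega>. indicator {\<omega> \<in> space M. telegraph c0 c1 e t \<omega> \<in> A} \<omega> \<partial>M)"
    by (rule nn_integral_indicator[symmetric]) measurable
  also have "\<dots> = (\<integral>\<^sup>+\<omega>. (\<Sum>n. indicator (E n) \<omega>) \<partial>M)"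
    by (rule nn_integral_cong_AE[OF split])
  also have "\<dots> = (\<Sum>n. emeasure M (E n))"
    by (subst nn_integral_suminf) auto
  also have "\<dots> = (\<Sum>n. emeasure M (E (Suc n))) + emeasure M (E 0)"
    by (intro sums_unique[symmetric] sums_Suc summable_sums) simp
  also have "emeasure M (E 0) = ennreal (exp (- c0 * t)) * indicator A t"
    unfolding E_def using X_dist[of 1] assms(3,5) by (intro emeasure_position_before_jumps) auto
  also have "(\<Sum>n. emeasure M (E (Suc n))) =
      (\<Sum>n. \<integral>\<^sup>+x. ennreal (position_density c0 c1 t (Suc n) x) * indicator A x \<partial>lborel)"
    unfolding E_def by (intro suminf_cong emeasure_position_after_jumps X_indep X_dist assms A) auto
  also have "\<dots> = (\<integral>\<^sup>+x. (\<Sum>n. ennreal (position_density c0 c1 t (Suc n) x) * indicator A x) \<partial>lborel)"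
    by (rule nn_integral_suminf[symmetric]) measurable
  also have "\<dots> = (\<integral>\<^sup>+x. ?d x * indicator A x \<partial>lborel)"
    using dens by (intro nn_integral_cong_AE) (auto elim!: eventually_mono simp: ennreal_suminf_multc)
  also have "\<dots> = emeasure (density lborel ?d) A"
    by (rule emeasure_density[symmetric]) auto
  finally show "emeasure (distr M borel (telegraph c0 c1 e t)) A =
         ennreal (exp (- c0 * t)) * emeasure (return borel t) A
         + emeasure (density lborel (\<lambda>x. ennreal (exp (- \<tau> * t) * f t x * indicator {-t..t} x))) A"
    by (simp add: add.commute)
qed

end
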